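(* Let $k$ be a positive integer, $l>0$, and let $\{T_1,\ldots,T_N\}$ be a normal $k$-fold translative packing of $lI^2$ with $T$. Then $\{S_1,S_2,\ldots,S_N\}$ is a $k$-fold packing of $lI^2$.
   Context: $T$ is the closed triangle with vertices $(0,0),(1,0),(0,1)$; $I=[0,1)$, so $lI^2=[0,l)^2$. A family of bounded sets $\{A_1,\ldots,A_N\}$ is a $k$-fold packing of $lI^2$ if $\bigcup A_i\subset lI^2$ and each point of $lI^2$ belongs to the interiors of at most $k$ of the sets $A_i$. A normal $k$-fold translative packing of $lI^2$ with $T$ is a finite $k$-fold packing $\{T_1,\ldots,T_N\}$ of $lI^2$ consisting of pairwise distinct translates of $T$. For a translate $T'=T+(x,y)$, put $I^2(T')=[x,x+1)\times[y,y+1)$ and $v(T')=(x,y)$. For points of $\mathbb{R}^2$, $(x_1,y_1)\prec(x_2,y_2)$ means that either $x_1+y_1<x_2+y_2$, or $x_1+y_1=x_2+y_2$ and $x_1<x_2$. For distinct translates $T',T''$ of $T$ with $I^2(T')\cap I^2(T'')\neq\emptyset$, $T'$ presses $T''$ if $v(T'')\prec v(T')$. For a nonempty bounded set $K$, $v(K)$ is the $\prec$-greatest point $u$ such that $u\prec u'$ or $u=u'$ for all $u'\in K$; for a nonempty half-open rectangle, $v([a,b)\times[c,d))=(a,c)$. Let $R(x_0,y_0)=\{(x,y):x\ge x_0,\ y\ge y_0\}$. Let $\mathcal{C}_i$ be the collection of those $T_j$ that press $T_i$, let $$U_i=\bigcup R\bigl(v(I^2(T_{i_1})\cap\cdots\cap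 I^2(T_{i_k}))\bigr),$$ the union over all choices of $k$ distinct $T_{i_1},\ldots,T_{i_k}\in\mathcal{C}_i$ with $I^2(T_{i_1})\cap\cdots\cap I^2(T_{i_k})\neq\emptyset$, and let $S_i=I^2(T_i)\setminus U_i$. *)

theory Defs
  imports "HOL-Analysis.Analysis"
begin

definition triangle :: "(real \<times> real) set" where
  "triangle = convex hull {(0, 0), (1, 0), (0, 1)}"

definition translate :: "real \<times> real \<Rightarrow> (real \<times> real) set" where
  "translate w = (\<lambda>p. p + w) ` triangle"

definition big_square :: "real \<Rightarrow> (real \<times> real) set" where
  "big_square l = {0..<l} \<times> {0..<l}"

text \<open>Families \<open>A\<^sub>1, \<dots>, A\<^sub>N\<close> are indexed by \<open>{1..N}\<close>, and multiplicity is counted by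
  index, so members that coincide as sets are counted separately.\<close>

definition kfold_packing ::
    "nat \<Rightarrow> real \<Rightarrow> nat \<Rightarrow> (nat \<Rightarrow> (real \<times> real) set) \<Rightarrow> bool" where
  "kfold_packing k l N A \<longleftrightarrow>
     (\<forall>i\<in>{1..N}. bounded (A i)) \<and>
     (\<Union>i\<in>{1..N}. A i) \<subseteq> big_square l \<and>
     (\<forall>p\<in>big_square l. card {i \<in> {1..N}. p \<in> interior (A i)} \<le> k)"

definition normal_packing ::
    "nat \<Rightarrow> real \<Rightarrow> nat \<Rightarrow> (nat \<Rightarrow> (real \<times> real) set) \<Rightarrow> bool" where
  "normal_packing k l N T \<longleftrightarrow>
     kfold_packing k l N T \<and>
     (\<forall>i\<in>{1..N}. \<exists>w. T i = translate w) \<and>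
     inj_on T {1..N}"

definition prec :: "real \<times> real \<Rightarrow> real \<times> real \<Rightarrow> bool" (infix "\<prec>\<^sub>s" 50) where
  "p \<prec>\<^sub>s q \<longleftrightarrow> fst p + snd p < fst q + snd q \<or>
             (fst p + snd p = fst q + snd q \<and> fst p < fst q)"

definition corner :: "(real \<times> real) set \<Rightarrow> real \<times> real" where
  "corner T' = (THE w. T' = translate w)"

definition unit_square :: "(real \<times> real) set \<Rightarrow> (real \<times> real) set" where
  "unit_square T' = {fst (corner T')..<fst (corner T') + 1} \<times>
                    {snd (corner T')..<snd (corner T') + 1}"

definition presses :: "(real \<times> real) set \<Rightarrow> (real \<times> real) set \<Rightarrow> bool" where
  "presses T' T'' \<longleftrightarrow> T' \<noteq> T'' \<and> unit_square T' \<inter> unit_square T'' \<noteq> {} \<and>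
                     corner T'' \<prec>\<^sub>s corner T'"

definition prec_lower :: "real \<times> real \<Rightarrow> (real \<times> real) set \<Rightarrow> bool" where
  "prec_lower u K \<longleftrightarrow> (\<forall>u'\<in>K. u \<prec>\<^sub>s u' \<or> u = u')"

text \<open>The \<open>\<prec>\<^sub>s\<close>-greatest lower bound. It exists whenever \<open>K\<close> has a \<open>\<prec>\<^sub>s\<close>-least element, as
  translates of the triangle and nonempty half-open rectangles do; a bounded set whose infimum
  of \<open>x + y\<close> is not attained has none.\<close>

definition prec_inf :: "(real \<times> real) set \<Rightarrow> real \<times> real" where
  "prec_inf K = (THE u. prec_lower u K \<and> (\<forall>w. prec_lower w K \<longrightarrow> w \<prec>\<^sub>s u \<or> w = u))"

definition quadrant :: "real \<times> real \<Rightarrow> (real \<times> real) set" where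
  "quadrant p = {q. fst q \<ge> fst p \<and> snd q \<ge> snd p}"

text \<open>In the notation \<open>\<C>\<^sub>i\<close>, \<open>U\<^sub>i\<close>, \<open>S\<^sub>i\<close> for the family \<open>T\<^sub>1, \<dots>, T\<^sub>N\<close>:
  \<open>\<C>\<^sub>i\<close> is \<open>pressing\<close>, \<open>U\<^sub>i\<close> is \<open>cutoff\<close> and \<open>S\<^sub>i\<close> is \<open>stair\<close>.\<close>

definition pressing ::
    "nat \<Rightarrow> (nat \<Rightarrow> (real \<times> real) set) \<Rightarrow> nat \<Rightarrow> (real \<times> real) set set" where
  "pressing N T i = {T j | j. j \<in> {1..N} \<and> presses (T j) (T i)}"

definition cutoff ::
    "nat \<Rightarrow> nat \<Rightarrow> (nat \<Rightarrow> (real \<times> real) set) \<Rightarrow> nat \<Rightarrow> (real \<times> real) set" where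
  "cutoff k N T i =
     \<Union> {quadrant (prec_inf (\<Inter>T'\<in>\<D>. unit_square T')) | \<D>.
          \<D> \<subseteq> pressing N T i \<and> card \<D> = k \<and> (\<Inter>T'\<in>\<D>. unit_square T') \<noteq> {}}"

definition stair ::
    "nat \<Rightarrow> nat \<Rightarrow> (nat \<Rightarrow> (real \<times> real) set) \<Rightarrow> nat \<Rightarrow> (real \<times> real) set" where
  "stair k N T i = unit_square (T i) - cutoff k N T i"

lemma prec_inf_eqI:
  assumes "u \<in> K" "\<And>u'. u' \<in> K \<Longrightarrow> u \<prec>\<^sub>s u' \<or> u = u'"
  shows "prec_inf K = u"
  unfolding prec_inf_def
proof (rule the_equality)
  show "prec_lower u K \<and> (\<forall>w. prec_lower w K \<longrightarrow> w \<prec>\<^sub>s u \<or> w = u)"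
    using assms by (auto simp: prec_lower_def)
next
  fix u' assume *: "prec_lower u' K \<and> (\<forall>w. prec_lower w K \<longrightarrow> w \<prec>\<^sub>s u' \<or> w = u')"
  have "u \<prec>\<^sub>s u' \<or> u = u'" using * assms(2) unfolding prec_lower_def by blast
  moreover have "u' \<prec>\<^sub>s u \<or> u' = u" using * assms(1) by (auto simp: prec_lower_def)
  ultimately show "u' = u" by (auto simp: prec_def)
qed

lemma prec_inf_rectangle:
  assumes "a < b" "c < d"
  shows "prec_inf ({a..<b} \<times> {c..<d}) = (a, c)"
  using assms by (intro prec_inf_eqI) (auto simp: prec_def)

lemma triangle_eq: "triangle = {p. 0 \<le> fst p \<and> 0 \<le> snd p \<and> fst p + snd p \<le> 1}"
proof -
  have "p \<in> triangle \<longleftrightarrow> 0 \<le> fst p \<and> 0 \<le> snd p \<and> fst p + snd p \<le> 1" for p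
  proof
    assume "0 \<le> fst p \<and> 0 \<le> snd p \<and> fst p + snd p \<le> 1"
    then show "p \<in> triangle"
      unfolding triangle_def convex_hull_3
      by (intro CollectI exI[of _ "1 - fst p - snd p"] exI[of _ "fst p"] exI[of _ "snd p"])
        (auto simp: prod_eq_iff)
  qed (auto simp: triangle_def convex_hull_3)
  then show ?thesis by auto
qed

lemma prec_inf_translate: "prec_inf (translate w) = w"
proof (rule prec_inf_eqI)
  have "(0, 0) \<in> triangle" by (simp add: triangle_eq)
  then show "w \<in> translate w" unfolding translate_def by (force simp: prod_eq_iff)
next
  fix u' assume "u' \<in> translate w"
  then show "w \<prec>\<^sub>s u' \<or> w = u'"
    by (auto simp: translate_def triangle_eq prec_def prod_eq_iff)
qed

lemma corner_translate: "corner (translate w) = w"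
  unfolding corner_def by (rule the_equality) (auto dest: arg_cong[of _ _ prec_inf]
      simp: prec_inf_translate)

end

theory Submission
  imports Defs
begin

text \<open>
  The unit square spanned by a triangle of the packing already lies in the big square, because
  the three vertices of the triangle do; so boundedness and containment of the stairs are
  inherited from the unit squares.

  The multiplicity bound holds because a point \<open>p\<close> common to \<open>k + 1\<close> unit squares is cut off
  from one of them. The corners of these squares are distinct, so one of them, say the \<open>i\<close>-th, is
  strictly \<open>\<prec>\<^sub>s\<close>-least. All squares contain \<open>p\<close>, so the \<open>k\<close> other triangles press the \<open>i\<close>-th one,
  and they form a family that occurs in the definition of the \<open>i\<close>-th cutoff. Their squares
  intersect in a half-open rectangle containing \<open>p\<close>, so \<open>p\<close> lies in the quadrant above the
  lower left vertex of this rectangle (\<open>mem_quadrant_prec_inf_Inter\<close>), and hence \<open>p\<close> does not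
  belong to the \<open>i\<close>-th stair.
\<close>

lemma transp_prec: "transp (\<prec>\<^sub>s)"
  by (rule transpI) (auto simp: prec_def)

lemma asymp_prec: "asymp (\<prec>\<^sub>s)"
  by (rule asympI) (auto simp: prec_def)

lemma prec_linear: "u \<noteq> v \<Longrightarrow> u \<prec>\<^sub>s v \<or> v \<prec>\<^sub>s u"
  by (auto simp: prec_def prod_eq_iff)

lemma prec_if_componentwise_le:
  "fst u \<le> fst v \<Longrightarrow> snd u \<le> snd v \<Longrightarrow> u \<prec>\<^sub>s v \<or> u = v"
  by (auto simp: prec_def prod_eq_iff)

lemma translate_eq:
  "translate w = {p. fst w \<le> fst p \<and> snd w \<le> snd p \<and> fst p + snd p \<le> fst w + snd w + 1}"
proof (intro set_eqI iffI)
  fix p assume "p \<in> {p. fst w \<le> fst p \<and> snd w \<le> snd p \<and> fst p + snd p \<le> fst w + snd w + 1}"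
  then have "p - w \<in> triangle" by (auto simp: triangle_eq)
  then show "p \<in> translate w" unfolding translate_def by (intro image_eqI[of _ _ "p - w"]) auto
qed (auto simp: translate_def triangle_eq)

text \<open>The vertices \<open>w\<close>, \<open>w + (1, 0)\<close> and \<open>w + (0, 1)\<close> of the triangle determine the bounds of
  its unit square.\<close>

lemma unit_square_translate_subset_big_square:
  assumes "translate w \<subseteq> big_square l"
  shows "unit_square (translate w) \<subseteq> big_square l"
proof -
  have "w \<in> big_square l" "w + (1, 0) \<in> big_square l" "w + (0, 1) \<in> big_square l"
    using assms by (auto simp: translate_eq)
  then show ?thesis
    by (cases w) (auto simp: unit_square_def corner_translate big_square_def)
qed

lemma bounded_big_square: "bounded (big_square l)"
  unfolding big_square_def by (intro bounded_Times) auto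

text \<open>The intersection of the squares has a least element for the componentwise order, namely the
  pair of the maxima of the corner coordinates. As \<open>\<prec>\<^sub>s\<close> extends the componentwise order, this
  pair is the \<open>\<prec>\<^sub>s\<close>-infimum.\<close>

lemma mem_quadrant_prec_inf_Inter:
  assumes "finite D" "D \<noteq> {}" and p: "p \<in> (\<Inter>T'\<in>D. unit_square T')"
  shows "p \<in> quadrant (prec_inf (\<Inter>T'\<in>D. unit_square T'))"
proof -
  define a where "a = Max ((fst \<circ> corner) ` D)"
  define c where "c = Max ((snd \<circ> corner) ` D)"
  have ub: "fst (corner T') \<le> a" "snd (corner T') \<le> c" if "T' \<in> D" for T'
    using that \<open>finite D\<close> by (auto simp: a_def c_def)
  have lb: "a \<le> fst q" "c \<le> snd q" if "q \<in> (\<Inter>T'\<in>D. unit_square T')" for q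
    using that assms(1,2) by (auto simp: a_def c_def unit_square_def mem_Times_iff)
  have "prec_inf (\<Inter>T'\<in>D. unit_square T') = (a, c)"
  proof (rule prec_inf_eqI)
    \<comment> \<open>The strict upper bounds hold at \<open>p\<close>, hence also at the smaller point \<open>(a, c)\<close>.\<close>
    show "(a, c) \<in> (\<Inter>T'\<in>D. unit_square T')"
      using p ub lb[OF p] by (fastforce simp: unit_square_def mem_Times_iff)
  next
    fix q assume "q \<in> (\<Inter>T'\<in>D. unit_square T')"
    then show "(a, c) \<prec>\<^sub>s q \<or> (a, c) = q"
      using lb by (intro prec_if_componentwise_le) auto
  qed
  then show ?thesis using lb[OF p] by (simp add: quadrant_def)
qed

text \<open>This is the heart of the argument: among the triangles whose squares contain \<open>p\<close>, the
  one with the \<open>\<prec>\<^sub>s\<close>-least corner is pressed by all the others.\<close>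

lemma ex_mem_cutoff:
  assumes "k > 0" and J: "J \<subseteq> {1..N}" "card J = Suc k"
    and inj: "inj_on T J" and trans: "\<forall>j\<in>J. \<exists>w. T j = translate w"
    and p: "\<forall>j\<in>J. p \<in> unit_square (T j)"
  shows "\<exists>i\<in>J. p \<in> cutoff k N T i"
proof -
  have inj': "inj_on (corner \<circ> T) J"
    using inj trans unfolding inj_on_def comp_def by (metis corner_translate)
  have "finite J" "J \<noteq> {}" using J by (auto intro: finite_subset)
  then have "\<exists>m\<in>(corner \<circ> T) ` J. \<forall>u\<in>(corner \<circ> T) ` J. u \<noteq> m \<longrightarrow> \<not> u \<prec>\<^sub>s m"
    by (intro Finite_Set.bex_min_element transp_on_subset[OF transp_prec]
        asymp_on_subset[OF asymp_prec]) auto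
  then obtain i where i: "i \<in> J"
    and min: "\<And>j. j \<in> J \<Longrightarrow> corner (T j) \<noteq> corner (T i) \<Longrightarrow> \<not> corner (T j) \<prec>\<^sub>s corner (T i)"
    by auto
  define D where "D = T ` (J - {i})"
  have "presses (T j) (T i)" if "j \<in> J - {i}" for j
  proof -
    have "corner (T j) \<noteq> corner (T i)" "T j \<noteq> T i"
      using that i inj_on_eq_iff[OF inj', of j i] by auto
    moreover have "unit_square (T j) \<inter> unit_square (T i) \<noteq> {}"
      using that i p by blast
    ultimately show ?thesis
      unfolding presses_def using min prec_linear that by blast
  qed
  then have pressing: "D \<subseteq> pressing N T i"
    using J(1) unfolding D_def pressing_def by blast
  have card: "card D = k"
    using J i \<open>finite J\<close> inj by (simp add: D_def card_image inj_on_diff)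
  then have D: "finite D" "D \<noteq> {}"
    using \<open>k > 0\<close> by (auto intro: card_ge_0_finite)
  have pD: "p \<in> (\<Inter>T'\<in>D. unit_square T')"
    using p by (auto simp: D_def)
  have "p \<in> cutoff k N T i"
    unfolding cutoff_def using mem_quadrant_prec_inf_Inter[OF D pD] pressing card pD by blast
  then show ?thesis using i by blast
qed

theorem lemma4p5:
  fixes k N :: nat and l :: real and T :: "nat \<Rightarrow> (real \<times> real) set"
  assumes "k > 0" and "l > 0" and "normal_packing k l N T"
  shows "kfold_packing k l N (stair k N T)"
proof -
  have trans: "\<forall>i\<in>{1..N}. \<exists>w. T i = translate w" and inj: "inj_on T {1..N}"
    and sub: "\<forall>i\<in>{1..N}. T i \<subseteq> big_square l"
    using assms(3) by (auto simp: normal_packing_def kfold_packing_def)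
  have stair_sub: "stair k N T i \<subseteq> big_square l" if "i \<in> {1..N}" for i
  proof -
    from trans that obtain w where "T i = translate w" by blast
    then have "unit_square (T i) \<subseteq> big_square l"
      using sub that unit_square_translate_subset_big_square by metis
    then show ?thesis by (auto simp: stair_def)
  qed
  have "card {i \<in> {1..N}. p \<in> interior (stair k N T i)} \<le> k" for p
  proof (rule ccontr)
    assume "\<not> ?thesis"
    then obtain J where J: "J \<subseteq> {i \<in> {1..N}. p \<in> interior (stair k N T i)}" "card J = Suc k"
      by (meson obtain_subset_with_card_n not_less_eq_eq)
    then have p: "p \<in> stair k N T j" if "j \<in> J" for j
      using that interior_subset by blast
    have "J \<subseteq> {1..N}" using J by blast
    then have "\<exists>i\<in>J. p \<in> cutoff k N T i"
      using J trans inj p \<open>k > 0\<close>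
      by (intro ex_mem_cutoff) (auto simp: stair_def intro: inj_on_subset)
    then show False using p by (auto simp: stair_def)
  qed
  then show ?thesis
    unfolding kfold_packing_def using stair_sub bounded_subset[OF bounded_big_square] by blast
qed

end
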